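(* For $n\ge 4$ the containment of $\mathrm{AHI}$ in $\Sigma_{n,2d}\cap\mathcal{C}_{n,2d}$ is proper: $\mathrm{AHI}\subsetneq\Sigma_{n,2d}\cap\mathcal{C}_{n,2d}$.
   Context: AHI polynomials: a polynomial in $n$ variables is an AHI polynomial if it has the form $p(x)=\big(\sum_{i=1}^n \lambda_i x^{\alpha(i)}\big)\big(\sum_{i=1}^n \lambda_i \prod_{j\neq i,\,j=1}^n x^{\alpha(j)}\big)-c\prod_{i=1}^n x^{\alpha(i)}$, where $\lambda_i\ge 0$, each $x^{\alpha(i)}$ is a squared monomial in the $n$ variables $x_1,\dots,x_n$ (all exponents even non-negative integers) of degree at most $2d$, and $c$ is a real number. $\mathrm{AHI}$ denotes the set of those AHI polynomials that are non-negative on $\mathbb{R}^n$. $\Sigma_{n,2d}$ is the cone of sum of squares (SOS) polynomials in $n$ variables of degree at most $2d$, i.e. those that are finite sums of squares of real polynomials. Circuit polynomials: a circuit polynomial is a polynomial $g=\sum_{j=0}^m b_jx^{a(j)}+c'x^{y}$ where $a(0),\dots,a(m)\in(2\mathbb{Z}_{\ge0})^n$ are affinely independent, $b_j>0$, $c'\in\mathbb{R}$, and $y\in\mathbb{Z}_{\ge 0}^n$ lies in the relative interior of the simplex $\operatorname{conv}\{a(0),\dots,a(m)\}$; monomial squares $b\,x^{a}$ with $b>0$, $a\in(2\mathbb{Z}_{\ge0})^n$ are included as a degenerate case. $\mathcal{C}_{n,2d}$ is the SONC cone (sums of non-negative circuit polynomials): the set of finite non-negative linear combinations of circuit polynomials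 in $n$ variables of degree at most $2d$ that are non-negative on $\mathbb{R}^n$.
   Formalization: AHI is taken as the non-negative AHI polynomials that themselves have degree at most 2d (otherwise x_1^{2dn}, from all λ_i = 0, c = −1, lies in AHI but not in Σ_{n,2d}), and d ≥ 1 is assumed (for d = 0 the sets coincide). *)

theory Defs
  imports "HOL-Analysis.Analysis" "HOL-Library.Poly_Mapping"
begin

text \<open>
  Real polynomials in the variables \<open>x\<^sub>i\<close>, \<open>i :: 'n\<close>, are finitely supported maps from exponent
  vectors to coefficients. The ring structure (convolution product) is that of
  \<^theory>\<open>HOL-Library.Poly_Mapping\<close>. The number \<open>n\<close> of variables is \<open>CARD('n)\<close>.
\<close>

type_synonym 'n expo = "'n \<Rightarrow>\<^sub>0 nat"
type_synonym 'n rpoly = "('n \<Rightarrow>\<^sub>0 nat) \<Rightarrow>\<^sub>0 real"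

definition term_of :: "real \<Rightarrow> 'n expo \<Rightarrow> 'n rpoly"  \<comment> \<open>\<open>c x\<^sup>\<alpha>\<close>\<close>
  where "term_of c \<alpha> = Poly_Mapping.single \<alpha> c"

abbreviation const_poly :: "real \<Rightarrow> 'n rpoly"
  where "const_poly c \<equiv> term_of c 0"

abbreviation monom_of :: "'n expo \<Rightarrow> 'n rpoly"
  where "monom_of \<alpha> \<equiv> term_of 1 \<alpha>"

definition expo_degree :: "('n::finite) expo \<Rightarrow> nat"
  where "expo_degree \<alpha> = (\<Sum>i\<in>UNIV. Poly_Mapping.lookup \<alpha> i)"

definition expo_even :: "'n expo \<Rightarrow> bool"
  where "expo_even \<alpha> \<longleftrightarrow> (\<forall>i. even (Poly_Mapping.lookup \<alpha> i))"

definition expo_vec :: "('n::finite) expo \<Rightarrow> real ^ 'n"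
  where "expo_vec \<alpha> = (\<chi> i. real (Poly_Mapping.lookup \<alpha> i))"

text \<open>Total degree at most \<open>D\<close>; the zero polynomial satisfies every bound.\<close>

definition degree_le :: "('n::finite) rpoly \<Rightarrow> nat \<Rightarrow> bool"
  where "degree_le p D \<longleftrightarrow> (\<forall>\<alpha>\<in>Poly_Mapping.keys p. expo_degree \<alpha> \<le> D)"

definition poly_eval :: "('n::finite) rpoly \<Rightarrow> real ^ 'n \<Rightarrow> real"
  where "poly_eval p x =
    (\<Sum>\<alpha>\<in>Poly_Mapping.keys p. Poly_Mapping.lookup p \<alpha> * (\<Prod>i\<in>UNIV. (x $ i) ^ Poly_Mapping.lookup \<alpha> i))"

definition nonneg_poly :: "('n::finite) rpoly \<Rightarrow> bool"
  where "nonneg_poly p \<longleftrightarrow> (\<forall>x. poly_eval p x \<ge> 0)"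

text \<open>
  The number of squared monomials of an AHI polynomial equals the number of variables, so both are
  indexed by \<open>'n\<close>.
\<close>

definition AHI_polynomial :: "nat \<Rightarrow> ('n::finite) rpoly \<Rightarrow> bool"
  where "AHI_polynomial D p \<longleftrightarrow>
    (\<exists>(lam :: 'n \<Rightarrow> real) (\<alpha> :: 'n \<Rightarrow> 'n expo) (c :: real).
       (\<forall>i. lam i \<ge> 0) \<and>
       (\<forall>i. expo_even (\<alpha> i) \<and> expo_degree (\<alpha> i) \<le> D) \<and>
       p = (\<Sum>i\<in>UNIV. term_of (lam i) (\<alpha> i)) *
             (\<Sum>i\<in>UNIV. const_poly (lam i) * (\<Prod>j\<in>UNIV - {i}. monom_of (\<alpha> j)))
           - const_poly c * (\<Prod>i\<in>UNIV. monom_of (\<alpha> i)))"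

text \<open>
  Bounding the degree of the squared monomials by \<open>D\<close> only bounds the degree of an AHI polynomial
  by \<open>n D\<close>. To be comparable with the cones of polynomials of degree at most \<open>D\<close>, the set \<open>AHI\<close>
  is taken inside the space of polynomials of degree at most \<open>D\<close>.
\<close>

definition AHI :: "nat \<Rightarrow> ('n::finite) rpoly set"
  where "AHI D = {p. AHI_polynomial D p \<and> degree_le p D \<and> nonneg_poly p}"

definition SOS :: "nat \<Rightarrow> ('n::finite) rpoly set"
  where "SOS D = {p. degree_le p D \<and> (\<exists>(r::nat) q. p = (\<Sum>k<r. (q k)\<^sup>2))}"

text \<open>
  Affine independence is that of the family \<open>a(0), \<dots>, a(m)\<close>, hence the injectivity requirement.
\<close>

definition circuit_polynomial :: "('n::finite) rpoly \<Rightarrow> bool"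
  where "circuit_polynomial g \<longleftrightarrow>
    (\<exists>(m::nat) a b c' y.
       (\<forall>j\<le>m. expo_even (a j) \<and> b j > 0) \<and>
       inj_on a {..m} \<and> \<not> affine_dependent ((\<lambda>j. expo_vec (a j)) ` {..m}) \<and>
       expo_vec y \<in> rel_interior (convex hull ((\<lambda>j. expo_vec (a j)) ` {..m})) \<and>
       g = (\<Sum>j\<le>m. term_of (b j) (a j)) + term_of c' y) \<or>
    (\<exists>b a. b > 0 \<and> expo_even a \<and> g = term_of b a)"

definition SONC :: "nat \<Rightarrow> ('n::finite) rpoly set"
  where "SONC D =
    {p. \<exists>(r::nat) \<mu> g.
       (\<forall>k<r. \<mu> k \<ge> 0 \<and> circuit_polynomial (g k) \<and> degree_le (g k) D \<and> nonneg_poly (g k)) \<and>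
       p = (\<Sum>k<r. const_poly (\<mu> k) * g k)}"

end

theory Submission
  imports Defs
begin

text \<open>
  Write \<open>N\<close> for the sum of all \<open>\<alpha>(k)\<close>, and \<open>a(i,j)\<close> for the exponent obtained from \<open>N\<close> by exchanging
  the summand \<open>\<alpha>(j)\<close> for a second copy of \<open>\<alpha>(i)\<close>. Multiplying out, an AHI polynomial is
  \<open>\<Sum>\<^bsub>i,j\<^esub> \<lambda>\<^sub>i \<lambda>\<^sub>j x\<^bsup>a(i,j)\<^esup> - c x\<^sup>N\<close>. The exponents \<open>a(i,j)\<close> and \<open>a(j,i)\<close> are even, carry the same
  coefficient and have \<open>N\<close> as their midpoint. Completing each such pair gives
  \<open>p = \<Sum>\<^bsub>i,j\<^esub> (\<lambda>\<^sub>i \<lambda>\<^sub>j / 2) (x\<^bsup>a(i,j)\<^esup> + x\<^bsup>a(j,i)\<^esup> - 2 x\<^sup>N) + C x\<^sup>N\<close> with \<open>C = (\<Sum>\<^sub>i \<lambda>\<^sub>i)\<^sup>2 - c\<close>.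

  If \<open>a + b = 2 m\<close> with \<open>a\<close>, \<open>b\<close> even, then \<open>x\<^sup>a + x\<^sup>b - 2 x\<^sup>m = (x\<^bsup>a/2\<^esup> - x\<^bsup>b/2\<^esup>)\<^sup>2\<close> is at the same time
  a square and a non-negative circuit polynomial whose simplex is a segment. Evaluating \<open>p\<close> at
  \<open>(1, \<dots>, 1)\<close> gives \<open>C\<close>, so \<open>C \<ge> 0\<close> when \<open>p\<close> is non-negative, and the containment follows,
  apart from the degree bound that the SONC cone imposes on every circuit polynomial separately.
  For that bound, note that away from \<open>N\<close> all coefficients of \<open>p\<close> are sums of products \<open>\<lambda>\<^sub>i \<lambda>\<^sub>j \<ge> 0\<close>,
  so nothing cancels there, and that the degree of \<open>N\<close> is the mean of the degrees of \<open>a(i,j)\<close>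
  and \<open>a(j,i)\<close>.

  The containment is proper because the support of an AHI polynomial is, away from \<open>N\<close>, symmetric
  under reflection in the even exponent \<open>N\<close>. The support \<open>{0, 2 e\<^sub>i}\<close> of \<open>1 + x\<^sub>i\<^sup>2\<close> has no
  such symmetry, as the midpoint \<open>e\<^sub>i\<close> of its two elements is not even.
\<close>

section \<open>Exponents and evaluation\<close>

lemma expo_degree_add: "expo_degree (\<alpha> + \<beta>) = expo_degree \<alpha> + expo_degree \<beta>"
  by (simp add: expo_degree_def lookup_add sum.distrib)

lemma expo_even_add: "expo_even \<alpha> \<Longrightarrow> expo_even \<beta> \<Longrightarrow> expo_even (\<alpha> + \<beta>)"
  by (simp add: expo_even_def lookup_add)

lemma expo_even_sum: "(\<And>i. i \<in> A \<Longrightarrow> expo_even (\<alpha> i)) \<Longrightarrow> expo_even (\<Sum>i\<in>A. \<alpha> i)"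
  by (auto simp: expo_even_def lookup_sum intro: dvd_sum)

lemma expo_even_halve:
  assumes "expo_even \<alpha>"
  obtains \<beta> where "\<alpha> = \<beta> + \<beta>"
proof
  show "\<alpha> = Poly_Mapping.map (\<lambda>n. n div 2) \<alpha> + Poly_Mapping.map (\<lambda>n. n div 2) \<alpha>"
    using assms
    by (intro poly_mapping_eqI)
       (simp add: lookup_add map.rep_eq when_def expo_even_def flip: mult_2)
qed

lemma expo_double_cancel:
  fixes \<alpha> \<beta> :: "'n expo"
  assumes "\<alpha> + \<alpha> = \<beta> + \<beta>"
  shows "\<alpha> = \<beta>"
proof (rule poly_mapping_eqI)
  fix k
  have "Poly_Mapping.lookup (\<alpha> + \<alpha>) k = Poly_Mapping.lookup (\<beta> + \<beta>) k"
    using assms by simp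
  then show "Poly_Mapping.lookup \<alpha> k = Poly_Mapping.lookup \<beta> k"
    by (simp add: lookup_add)
qed

lemma expo_even_midpoint:
  assumes "expo_even a" "expo_even b" "a + b = m + m"
  obtains u v where "a = u + u" "b = v + v" "m = u + v"
proof -
  obtain u where u: "a = u + u"
    using assms(1) by (rule expo_even_halve)
  obtain v where v: "b = v + v"
    using assms(2) by (rule expo_even_halve)
  have m: "m = u + v"
    by (rule expo_double_cancel) (simp add: assms(3)[symmetric] u v ac_simps)
  show thesis
    using u v m by (rule that)
qed

lemma expo_vec_inj: "expo_vec \<alpha> = expo_vec \<beta> \<Longrightarrow> \<alpha> = \<beta>"
  by (rule poly_mapping_eqI) (simp add: expo_vec_def vec_eq_iff)

definition monom_val :: "('n::finite) expo \<Rightarrow> real ^ 'n \<Rightarrow> real"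
  where "monom_val \<alpha> x = (\<Prod>i\<in>UNIV. (x $ i) ^ Poly_Mapping.lookup \<alpha> i)"

lemma monom_val_add: "monom_val (\<alpha> + \<beta>) x = monom_val \<alpha> x * monom_val \<beta> x"
  by (simp add: monom_val_def lookup_add power_add prod.distrib)

lemma poly_eval_superset:
  assumes "finite S" "Poly_Mapping.keys p \<subseteq> S"
  shows "poly_eval p x = (\<Sum>\<alpha>\<in>S. Poly_Mapping.lookup p \<alpha> * monom_val \<alpha> x)"
  unfolding poly_eval_def monom_val_def
  using assms by (intro sum.mono_neutral_left) (auto simp: in_keys_iff)

lemma poly_eval_add: "poly_eval (p + q) x = poly_eval p x + poly_eval q x"
proof -
  let ?S = "Poly_Mapping.keys p \<union> Poly_Mapping.keys q"
  have "Poly_Mapping.keys (p + q) \<subseteq> ?S"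
    by (rule keys_add)
  then show ?thesis
    by (simp add: poly_eval_superset[of ?S] lookup_add distrib_right sum.distrib)
qed

lemma poly_eval_sum: "poly_eval (\<Sum>s\<in>S. p s) x = (\<Sum>s\<in>S. poly_eval (p s) x)"
  by (induction S rule: infinite_finite_induct) (simp_all add: poly_eval_add, simp_all add: poly_eval_def)

lemma poly_eval_term_of: "poly_eval (term_of c \<alpha>) x = c * monom_val \<alpha> x"
  by (subst poly_eval_superset[of "{\<alpha>}"]) (auto simp: term_of_def split: if_splits)

section \<open>Terms\<close>

lemma term_of_mult: "term_of a \<alpha> * term_of b \<beta> = term_of (a * b) (\<alpha> + \<beta>)"
  by (simp add: term_of_def mult_single)

lemma term_of_add: "term_of (a + b) \<alpha> = term_of a \<alpha> + term_of b \<alpha>"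
  by (simp add: term_of_def single_add)

lemma term_of_diff: "term_of (a - b) \<alpha> = term_of a \<alpha> - term_of b \<alpha>"
  by (simp add: term_of_def single_diff)

lemma term_of_0 [simp]: "term_of 0 \<alpha> = 0"
  by (simp add: term_of_def)

lemma term_of_minus: "term_of (- a) \<alpha> = - term_of a \<alpha>"
  by (simp add: term_of_def single_uminus)

lemma term_of_sum: "term_of (\<Sum>s\<in>S. f s) \<alpha> = (\<Sum>s\<in>S. term_of (f s) \<alpha>)"
  by (induction S rule: infinite_finite_induct) (simp_all add: term_of_add)

lemma prod_monom_of: "(\<Prod>s\<in>S. monom_of (\<alpha> s)) = monom_of (\<Sum>s\<in>S. \<alpha> s)"
  by (induction S rule: infinite_finite_induct)
     (simp_all add: term_of_mult, simp_all add: term_of_def)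

lemma lookup_term_of: "Poly_Mapping.lookup (term_of c \<alpha>) \<beta> = (if \<alpha> = \<beta> then c else 0)"
  by (simp add: term_of_def lookup_single when_def)

lemma degree_le_add: "degree_le p D \<Longrightarrow> degree_le q D \<Longrightarrow> degree_le (p + q) D"
  using keys_add[of p q] by (auto simp: degree_le_def)

lemma degree_le_term_of: "expo_degree \<alpha> \<le> D \<Longrightarrow> degree_le (term_of c \<alpha>) D"
  by (simp add: degree_le_def term_of_def)

section \<open>Sums of squares and sums of circuit polynomials\<close>

definition sum_of_squares :: "('n::finite) rpoly \<Rightarrow> bool"
  where "sum_of_squares p \<longleftrightarrow> (\<exists>(r::nat) q. p = (\<Sum>k<r. (q k)\<^sup>2))"

lemma sum_of_squares_0: "sum_of_squares 0"
  unfolding sum_of_squares_def by (rule exI[of _ 0]) simp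

lemma sum_of_squares_add_square:
  assumes "sum_of_squares p"
  shows "sum_of_squares (q\<^sup>2 + p)"
proof -
  obtain r :: nat and f where p: "p = (\<Sum>k<r. (f k)\<^sup>2)"
    using assms unfolding sum_of_squares_def by blast
  have "q\<^sup>2 + p = (\<Sum>k<Suc r. ((f(r := q)) k)\<^sup>2)"
    by (simp add: p)
  then show ?thesis
    unfolding sum_of_squares_def by blast
qed

lemma sum_of_squares_add_scaled_square:
  assumes "\<mu> \<ge> 0" "sum_of_squares p"
  shows "sum_of_squares (const_poly \<mu> * q\<^sup>2 + p)"
proof -
  have "(const_poly (sqrt \<mu>) * q)\<^sup>2 = const_poly (sqrt \<mu>) * const_poly (sqrt \<mu>) * q\<^sup>2"
    by (simp add: power2_eq_square algebra_simps)
  then have "const_poly \<mu> * q\<^sup>2 = (const_poly (sqrt \<mu>) * q)\<^sup>2"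
    using assms(1) by (simp add: term_of_mult)
  then show ?thesis
    using sum_of_squares_add_square[OF assms(2)] by simp
qed

lemma sum_of_squares_add_sum:
  assumes "finite S" "\<And>s. s \<in> S \<Longrightarrow> \<mu> s \<ge> 0" "sum_of_squares p"
  shows "sum_of_squares ((\<Sum>s\<in>S. const_poly (\<mu> s) * (q s)\<^sup>2) + p)"
  using assms
  by (induction S rule: finite_induct) (simp_all add: add.assoc sum_of_squares_add_scaled_square)

definition SONC_generator :: "nat \<Rightarrow> ('n::finite) rpoly \<Rightarrow> bool"
  where "SONC_generator D g \<longleftrightarrow> circuit_polynomial g \<and> degree_le g D \<and> nonneg_poly g"

lemma SONC_0: "0 \<in> SONC D"
  unfolding SONC_def by (intro CollectI exI[of _ 0]) simp

lemma SONC_add_generator: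
  assumes "\<mu> \<ge> 0" "SONC_generator D g" "p \<in> SONC D"
  shows "const_poly \<mu> * g + p \<in> SONC D"
proof -
  obtain r :: nat and \<nu> h where
    h: "\<forall>k<r. \<nu> k \<ge> 0 \<and> circuit_polynomial (h k) \<and> degree_le (h k) D \<and> nonneg_poly (h k)"
    and p: "p = (\<Sum>k<r. const_poly (\<nu> k) * h k)"
    using assms(3) unfolding SONC_def by blast
  have "const_poly \<mu> * g + p = (\<Sum>k<Suc r. const_poly ((\<nu>(r := \<mu>)) k) * (h(r := g)) k)"
    by (simp add: p)
  moreover have "\<forall>k<Suc r. (\<nu>(r := \<mu>)) k \<ge> 0 \<and> circuit_polynomial ((h(r := g)) k) \<and>
      degree_le ((h(r := g)) k) D \<and> nonneg_poly ((h(r := g)) k)"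
    using h assms(1,2) by (auto simp: SONC_generator_def less_Suc_eq)
  ultimately show ?thesis
    unfolding SONC_def by blast
qed

lemma SONC_add_sum:
  assumes "finite S" "\<And>s. s \<in> S \<Longrightarrow> \<mu> s \<ge> 0"
    and "\<And>s. s \<in> S \<Longrightarrow> const_poly (\<mu> s) * g s \<noteq> 0 \<Longrightarrow> SONC_generator D (g s)"
    and "p \<in> SONC D"
  shows "(\<Sum>s\<in>S. const_poly (\<mu> s) * g s) + p \<in> SONC D"
  using assms
proof (induction S rule: finite_induct)
  case (insert s S)
  then show ?case
    by (cases "const_poly (\<mu> s) * g s = 0") (simp_all add: add.assoc SONC_add_generator)
qed simp

lemma SONC_generator_square_monomial:
  fixes \<alpha> :: "('n::finite) expo"
  assumes "b > 0" "expo_even \<alpha>" "expo_degree \<alpha> \<le> D"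
  shows "SONC_generator D (term_of b \<alpha>)"
proof -
  obtain \<beta> where \<beta>: "\<alpha> = \<beta> + \<beta>"
    using assms(2) by (rule expo_even_halve)
  have "nonneg_poly (term_of b \<alpha>)"
    using assms(1) by (simp add: nonneg_poly_def poly_eval_term_of \<beta> monom_val_add)
  moreover have "circuit_polynomial (term_of b \<alpha>)"
    unfolding circuit_polynomial_def using assms by blast
  ultimately show ?thesis
    using assms(3) by (simp add: SONC_generator_def degree_le_term_of)
qed

section \<open>The polynomial of the arithmetic-geometric mean inequality for two monomials\<close>

definition amgm_poly :: "'n expo \<Rightarrow> 'n expo \<Rightarrow> 'n expo \<Rightarrow> ('n::finite) rpoly"
  where "amgm_poly a b m = term_of 1 a + term_of 1 b + term_of (-2) m"

lemma amgm_poly_square: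
  assumes "expo_even a" "expo_even b" "a + b = m + m"
  obtains q where "amgm_poly a b m = q\<^sup>2"
proof -
  obtain u v where u: "a = u + u" and v: "b = v + v" and m: "m = u + v"
    using assms by (rule expo_even_midpoint)
  have "(monom_of u - monom_of v)\<^sup>2
      = monom_of u * monom_of u + monom_of v * monom_of v
        - (monom_of u * monom_of v + monom_of u * monom_of v)"
    by (simp add: power2_eq_square algebra_simps)
  also have "\<dots> = term_of 1 a + term_of 1 b + (term_of 0 m - term_of (1 + 1) m)"
    by (simp only: term_of_mult u v m term_of_add) simp
  also have "\<dots> = amgm_poly a b m"
    by (simp add: amgm_poly_def term_of_minus)
  finally show ?thesis
    using that by metis
qed

lemma amgm_poly_nonneg:
  assumes "expo_even a" "expo_even b" "a + b = m + m"
  shows "nonneg_poly (amgm_poly a b m)"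
proof -
  obtain u v where u: "a = u + u" and v: "b = v + v" and m: "m = u + v"
    using assms by (rule expo_even_midpoint)
  have "poly_eval (amgm_poly a b m) x = (monom_val u x - monom_val v x)\<^sup>2" for x
    by (simp add: amgm_poly_def poly_eval_add poly_eval_term_of u v m monom_val_add
        power2_eq_square algebra_simps)
  then show ?thesis
    by (simp add: nonneg_poly_def)
qed

text \<open>
  The simplex is the segment from \<open>a\<close> to \<open>b\<close>, and \<open>m\<close> is its midpoint. This needs \<open>a \<noteq> b\<close>;
  for \<open>a = b\<close> the polynomial vanishes.
\<close>

lemma amgm_poly_circuit:
  assumes "expo_even a" "expo_even b" "a + b = m + m" "a \<noteq> b"
  shows "circuit_polynomial (amgm_poly a b m)"
proof -
  define e where "e = (\<lambda>j::nat. if j = 0 then a else b)"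
  have le1: "{..1} = {0, 1::nat}"
    by auto
  have e_image: "(\<lambda>j. expo_vec (e j)) ` {..1} = {expo_vec a, expo_vec b}"
    unfolding le1 by (simp add: e_def)
  have ne: "expo_vec a \<noteq> expo_vec b"
    using assms(4) expo_vec_inj by blast
  have "expo_vec m = midpoint (expo_vec a) (expo_vec b)"
  proof (subst vec_eq_iff, rule allI)
    fix i
    have "Poly_Mapping.lookup (a + b) i = Poly_Mapping.lookup (m + m) i"
      using assms(3) by simp
    then show "expo_vec m $ i = midpoint (expo_vec a) (expo_vec b) $ i"
      by (simp add: midpoint_def expo_vec_def lookup_add flip: of_nat_add)
  qed
  then have interior: "expo_vec m \<in> rel_interior (convex hull ((\<lambda>j. expo_vec (e j)) ` {..1}))"
    unfolding e_image segment_convex_hull[symmetric] using ne by (simp add: rel_interior_closed_segment)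
  have "inj_on e {..1}"
    unfolding le1 using assms(4) by (simp add: e_def)
  moreover have "\<not> affine_dependent ((\<lambda>j. expo_vec (e j)) ` {..1})"
    unfolding e_image by simp
  moreover have "\<forall>j\<le>1. expo_even (e j) \<and> (1::real) > 0"
    using assms by (simp add: e_def)
  moreover have "amgm_poly a b m = (\<Sum>j\<le>1. term_of 1 (e j)) + term_of (-2) m"
    by (simp add: amgm_poly_def le1 e_def)
  ultimately have "\<exists>(l::nat) a' b' c' y.
       (\<forall>j\<le>l. expo_even (a' j) \<and> b' j > 0) \<and>
       inj_on a' {..l} \<and> \<not> affine_dependent ((\<lambda>j. expo_vec (a' j)) ` {..l}) \<and>
       expo_vec y \<in> rel_interior (convex hull ((\<lambda>j. expo_vec (a' j)) ` {..l})) \<and>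
       amgm_poly a b m = (\<Sum>j\<le>l. term_of (b' j) (a' j)) + term_of c' y"
    using interior
    by (intro exI[of _ 1] exI[of _ e] exI[of _ "\<lambda>_. 1"] exI[of _ "-2"] exI[of _ m] conjI)
       simp_all
  then show ?thesis
    unfolding circuit_polynomial_def by (rule disjI1)
qed

lemma SONC_generator_amgm_poly:
  assumes "expo_even a" "expo_even b" "a + b = m + m" "a \<noteq> b"
    and "expo_degree a \<le> D" "expo_degree b \<le> D"
  shows "SONC_generator D (amgm_poly a b m)"
proof -
  have "expo_degree m + expo_degree m = expo_degree a + expo_degree b"
    using arg_cong[OF assms(3), of expo_degree] by (simp add: expo_degree_add)
  then have "degree_le (amgm_poly a b m) D"
    using assms(5,6) unfolding amgm_poly_def by (intro degree_le_add degree_le_term_of) auto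
  then show ?thesis
    unfolding SONC_generator_def using amgm_poly_circuit[OF assms(1-4)] amgm_poly_nonneg[OF assms(1-3)]
    by blast
qed

section \<open>The terms of an AHI polynomial\<close>

definition exchange :: "(('n::finite) \<Rightarrow> 'n expo) \<Rightarrow> 'n \<Rightarrow> 'n \<Rightarrow> 'n expo"
  where "exchange \<alpha> i j = \<alpha> i + (\<Sum>k\<in>UNIV - {j}. \<alpha> k)"

lemma exchange_add: "exchange \<alpha> i j + \<alpha> j = \<alpha> i + (\<Sum>k\<in>UNIV. \<alpha> k)"
  by (simp add: exchange_def sum.remove[of UNIV j] ac_simps)

lemma exchange_midpoint:
  "exchange \<alpha> i j + exchange \<alpha> j i = (\<Sum>k\<in>UNIV. \<alpha> k) + (\<Sum>k\<in>UNIV. \<alpha> k)"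
proof -
  have "exchange \<alpha> i j + exchange \<alpha> j i + (\<alpha> i + \<alpha> j)
      = (exchange \<alpha> i j + \<alpha> j) + (exchange \<alpha> j i + \<alpha> i)"
    by (simp add: ac_simps)
  also have "\<dots> = (\<Sum>k\<in>UNIV. \<alpha> k) + (\<Sum>k\<in>UNIV. \<alpha> k) + (\<alpha> i + \<alpha> j)"
    by (simp only: exchange_add) (simp add: ac_simps)
  finally show ?thesis
    by (rule add_right_imp_eq)
qed

lemma exchange_even: "(\<And>i. expo_even (\<alpha> i)) \<Longrightarrow> expo_even (exchange \<alpha> i j)"
  unfolding exchange_def by (intro expo_even_add expo_even_sum)

lemma AHI_expand:
  fixes lam :: "'n::finite \<Rightarrow> real"
  shows "(\<Sum>i\<in>UNIV. term_of (lam i) (\<alpha> i)) *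
      (\<Sum>i\<in>UNIV. const_poly (lam i) * (\<Prod>j\<in>UNIV - {i}. monom_of (\<alpha> j)))
    = (\<Sum>i\<in>UNIV. \<Sum>j\<in>UNIV. term_of (lam i * lam j) (exchange \<alpha> i j))"
  by (simp add: sum_product prod_monom_of term_of_mult exchange_def)

lemma AHI_polynomialE:
  fixes p :: "('n::finite) rpoly"
  assumes "AHI_polynomial D p"
  obtains lam \<alpha> c where "\<And>i. lam i \<ge> 0" "\<And>i. expo_even (\<alpha> i)"
    "p = (\<Sum>i\<in>UNIV. \<Sum>j\<in>UNIV. term_of (lam i * lam j) (exchange \<alpha> i j))
         - term_of c (\<Sum>k\<in>UNIV. \<alpha> k)"
proof -
  obtain lam \<alpha> c where "\<forall>i. lam i \<ge> 0" "\<forall>i. expo_even (\<alpha> i) \<and> expo_degree (\<alpha> i) \<le> D"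
    "p = (\<Sum>i\<in>UNIV. \<Sum>j\<in>UNIV. term_of (lam i * lam j) (exchange \<alpha> i j))
         - const_poly c * (\<Prod>i\<in>UNIV. monom_of (\<alpha> i))"
    using assms unfolding AHI_polynomial_def AHI_expand by blast
  then show thesis
    by (intro that[of lam \<alpha> c]) (simp_all add: prod_monom_of term_of_mult)
qed

text \<open>
  The sum runs over ordered pairs, so each pair of opposite terms is completed twice; this is why the
  weights are halved. The multiples of \<open>x\<^sup>N\<close> that are subtracted add up to
  \<open>\<Sum>\<^bsub>i,j\<^esub> \<lambda>\<^sub>i \<lambda>\<^sub>j = (\<Sum>\<^sub>i \<lambda>\<^sub>i)\<^sup>2\<close>.
\<close>

lemma AHI_amgm_decomposition:
  fixes lam :: "'n::finite \<Rightarrow> real"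
  shows "(\<Sum>i\<in>UNIV. \<Sum>j\<in>UNIV. term_of (lam i * lam j) (exchange \<alpha> i j)) - term_of c N
    = (\<Sum>(i, j)\<in>UNIV. const_poly (lam i * lam j / 2) *
          amgm_poly (exchange \<alpha> i j) (exchange \<alpha> j i) N)
      + term_of ((\<Sum>i\<in>UNIV. lam i)\<^sup>2 - c) N"
proof -
  let ?h = "\<lambda>i j. term_of (lam i * lam j / 2) (exchange \<alpha> i j)"
  have swap: "(\<Sum>i\<in>UNIV. \<Sum>j\<in>UNIV. term_of (lam i * lam j / 2) (exchange \<alpha> j i))
      = (\<Sum>i\<in>UNIV. \<Sum>j\<in>UNIV. ?h i j)"
    by (subst sum.swap) (simp add: mult.commute)
  have halves: "term_of (lam i * lam j) (exchange \<alpha> i j) = ?h i j + ?h i j" for i j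
    by (simp flip: term_of_add)
  have "(\<Sum>(i, j)\<in>UNIV. const_poly (lam i * lam j / 2) *
          amgm_poly (exchange \<alpha> i j) (exchange \<alpha> j i) N)
      = (\<Sum>i\<in>UNIV. \<Sum>j\<in>UNIV. ?h i j + term_of (lam i * lam j / 2) (exchange \<alpha> j i)
          + term_of (- (lam i * lam j)) N)"
    by (simp add: amgm_poly_def distrib_left term_of_mult sum.cartesian_product
        flip: UNIV_Times_UNIV)
  also have "\<dots> = (\<Sum>i\<in>UNIV. \<Sum>j\<in>UNIV. ?h i j) + (\<Sum>i\<in>UNIV. \<Sum>j\<in>UNIV. ?h i j)
      + term_of (- ((\<Sum>i\<in>UNIV. lam i)\<^sup>2)) N"
    by (simp add: sum.distrib swap term_of_sum[symmetric] sum_negf power2_eq_square sum_product)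
  also have "\<dots> = (\<Sum>i\<in>UNIV. \<Sum>j\<in>UNIV. term_of (lam i * lam j) (exchange \<alpha> i j))
      + term_of (- ((\<Sum>i\<in>UNIV. lam i)\<^sup>2)) N"
    by (simp only: halves sum.distrib)
  finally show ?thesis
    by (simp add: term_of_minus term_of_diff)
qed

text \<open>Only \<open>c\<close> is subtracted, and it is subtracted at \<open>N\<close>, so there is no cancellation elsewhere.\<close>

lemma AHI_key_iff:
  fixes lam :: "'n::finite \<Rightarrow> real"
  assumes "\<And>i. lam i \<ge> 0" "\<beta> \<noteq> N"
  shows "\<beta> \<in> Poly_Mapping.keys
      ((\<Sum>i\<in>UNIV. \<Sum>j\<in>UNIV. term_of (lam i * lam j) (exchange \<alpha> i j)) - term_of c N)
    \<longleftrightarrow> (\<exists>i j. lam i * lam j \<noteq> 0 \<and> exchange \<alpha> i j = \<beta>)"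
proof -
  let ?t = "\<lambda>i j. if exchange \<alpha> i j = \<beta> then lam i * lam j else 0"
  have nn: "?t i j \<ge> 0" for i j
    using assms(1) by simp
  have "Poly_Mapping.lookup
      ((\<Sum>i\<in>UNIV. \<Sum>j\<in>UNIV. term_of (lam i * lam j) (exchange \<alpha> i j)) - term_of c N) \<beta>
    = (\<Sum>i\<in>UNIV. \<Sum>j\<in>UNIV. ?t i j)"
    using assms(2) by (simp add: lookup_minus lookup_sum lookup_term_of)
  moreover have "(\<Sum>i\<in>UNIV. \<Sum>j\<in>UNIV. ?t i j) = 0 \<longleftrightarrow> (\<forall>i j. ?t i j = 0)"
    using nn by (simp add: sum_nonneg_eq_0_iff sum_nonneg)
  ultimately show ?thesis
    by (auto simp: in_keys_iff)
qed

text \<open>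
  This is the reflection of the support in \<open>N\<close>. A fixed point of the reflection would be a half of
  \<open>2 N\<close>, so the reflection of \<open>\<beta> \<noteq> N\<close> is again different from \<open>N\<close>.
\<close>

lemma AHI_keys_reflect:
  fixes p :: "('n::finite) rpoly"
  assumes "AHI_polynomial D p"
  obtains N where "expo_even N"
    "\<And>\<beta>. \<beta> \<in> Poly_Mapping.keys p \<Longrightarrow> \<beta> \<noteq> N \<Longrightarrow>
      \<exists>\<gamma>\<in>Poly_Mapping.keys p. \<gamma> \<noteq> N \<and> \<beta> + \<gamma> = N + N"
proof -
  obtain lam \<alpha> c where lam: "\<And>i. lam i \<ge> 0" and even: "\<And>i. expo_even (\<alpha> i)"
    and p: "p = (\<Sum>i\<in>UNIV. \<Sum>j\<in>UNIV. term_of (lam i * lam j) (exchange \<alpha> i j))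
         - term_of c (\<Sum>k\<in>UNIV. \<alpha> k)"
    using assms by (rule AHI_polynomialE) blast
  define N where "N = (\<Sum>k\<in>UNIV. \<alpha> k)"
  have key_iff: "\<beta> \<in> Poly_Mapping.keys p \<longleftrightarrow> (\<exists>i j. lam i * lam j \<noteq> 0 \<and> exchange \<alpha> i j = \<beta>)"
    if "\<beta> \<noteq> N" for \<beta>
    unfolding p N_def[symmetric] using lam that by (rule AHI_key_iff)
  show thesis
  proof
    show "expo_even N"
      unfolding N_def using even by (intro expo_even_sum)
    fix \<beta>
    assume "\<beta> \<in> Poly_Mapping.keys p" and \<beta>N: "\<beta> \<noteq> N"
    then obtain i j where ij: "lam i * lam j \<noteq> 0" "exchange \<alpha> i j = \<beta>"
      using key_iff by blast
    have sum: "\<beta> + exchange \<alpha> j i = N + N"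
      using exchange_midpoint[of \<alpha> i j] ij(2) by (simp add: N_def)
    then have ne: "exchange \<alpha> j i \<noteq> N"
      using \<beta>N by auto
    moreover have "exchange \<alpha> j i \<in> Poly_Mapping.keys p"
      using key_iff[OF ne] ij(1) by auto
    ultimately show "\<exists>\<gamma>\<in>Poly_Mapping.keys p. \<gamma> \<noteq> N \<and> \<beta> + \<gamma> = N + N"
      using sum by blast
  qed
qed

section \<open>The containment\<close>

lemma AHI_subset_SOS_SONC:
  fixes p :: "('n::finite) rpoly"
  assumes "p \<in> AHI D"
  shows "p \<in> SOS D \<inter> SONC D"
proof -
  have AHI: "AHI_polynomial D p" and deg: "degree_le p D" and nonneg: "nonneg_poly p"
    using assms by (auto simp: AHI_def)
  obtain lam \<alpha> c where lam: "\<And>i. lam i \<ge> 0" and even: "\<And>i. expo_even (\<alpha> i)"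
    and p: "p = (\<Sum>i\<in>UNIV. \<Sum>j\<in>UNIV. term_of (lam i * lam j) (exchange \<alpha> i j))
         - term_of c (\<Sum>k\<in>UNIV. \<alpha> k)"
    using AHI by (rule AHI_polynomialE) blast
  define N where "N = (\<Sum>k\<in>UNIV. \<alpha> k)"
  define C where "C = (\<Sum>i\<in>UNIV. lam i)\<^sup>2 - c"
  define \<mu> where "\<mu> = (\<lambda>(i, j). lam i * lam j / 2)"
  define g where "g = (\<lambda>(i, j). amgm_poly (exchange \<alpha> i j) (exchange \<alpha> j i) N)"
  note p = p[folded N_def]
  have p_eq: "p = (\<Sum>s\<in>UNIV. const_poly (\<mu> s) * g s) + term_of C N"
    unfolding p AHI_amgm_decomposition C_def \<mu>_def g_def by (simp add: case_prod_unfold)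
  have mid: "exchange \<alpha> i j + exchange \<alpha> j i = N + N" for i j
    unfolding N_def by (rule exchange_midpoint)
  have exch_even: "expo_even (exchange \<alpha> i j)" for i j
    using even by (rule exchange_even)
  have N_even: "expo_even N"
    unfolding N_def using even by (intro expo_even_sum)
  have \<mu>_nonneg: "\<mu> s \<ge> 0" for s
    using lam by (simp add: \<mu>_def case_prod_unfold)

  have "poly_eval p (\<chi> i. 1) = C"
  proof -
    have one: "monom_val \<beta> (\<chi> i. 1) = 1" for \<beta> :: "'n expo"
      by (simp add: monom_val_def)
    have "poly_eval p (\<chi> i. 1) + poly_eval (term_of c N) (\<chi> i. 1)
        = poly_eval (\<Sum>i\<in>UNIV. \<Sum>j\<in>UNIV. term_of (lam i * lam j) (exchange \<alpha> i j)) (\<chi> i. 1)"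
      by (simp add: p flip: poly_eval_add)
    then show ?thesis
      by (simp add: poly_eval_sum poly_eval_term_of one C_def power2_eq_square sum_product)
  qed
  then have C: "C \<ge> 0"
    using nonneg by (metis nonneg_poly_def)

  have exch_deg: "expo_degree (exchange \<alpha> i j) \<le> D"
    if "lam i * lam j \<noteq> 0" "exchange \<alpha> i j \<noteq> N" for i j
  proof -
    have "exchange \<alpha> i j \<in> Poly_Mapping.keys p"
      unfolding p using AHI_key_iff[of lam "exchange \<alpha> i j" N \<alpha> c] lam that by blast
    then show ?thesis
      using deg by (simp add: degree_le_def)
  qed
  have generator: "SONC_generator D (g s)" and N_deg: "expo_degree N \<le> D"
    if "const_poly (\<mu> s) * g s \<noteq> 0" for s
  proof -
    obtain i j where s: "s = (i, j)"
      by (cases s)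
    have lam_ij: "lam i * lam j \<noteq> 0" "lam j * lam i \<noteq> 0"
      using that by (auto simp: s \<mu>_def)
    have zero_if_N: "amgm_poly N N N = 0"
      by (simp add: amgm_poly_def flip: term_of_add)
    have ne: "exchange \<alpha> i j \<noteq> N" "exchange \<alpha> j i \<noteq> N"
      using that zero_if_N mid[of i j] by (auto simp: s g_def)
    have ne': "exchange \<alpha> i j \<noteq> exchange \<alpha> j i"
      using ne mid[of i j] expo_double_cancel by metis
    note degs = exch_deg[OF lam_ij(1) ne(1)] exch_deg[OF lam_ij(2) ne(2)]
    show "SONC_generator D (g s)"
      unfolding s g_def using degs ne' mid exch_even by (simp add: SONC_generator_amgm_poly)
    show "expo_degree N \<le> D"
      using degs arg_cong[OF mid[of i j], of expo_degree] by (simp add: expo_degree_add)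
  qed

  have "term_of C N \<in> SONC D"
  proof (cases "C = 0")
    case True
    then show ?thesis
      by (simp add: SONC_0)
  next
    case False
    \<comment> \<open>\<open>N\<close> may be missing from the support of \<open>p\<close>, but then some pair of opposite terms is present.\<close>
    have "expo_degree N \<le> D"
    proof (cases "\<exists>s. const_poly (\<mu> s) * g s \<noteq> 0")
      case True
      then show ?thesis
        using N_deg by blast
    next
      case no_pairs: False
      then have "(\<Sum>s\<in>UNIV. const_poly (\<mu> s) * g s) = 0"
        by (intro sum.neutral) blast
      then have "p = term_of C N"
        by (simp only: p_eq add_0)
      then show ?thesis
        using deg False by (simp add: degree_le_def term_of_def)
    qed
    then have "SONC_generator D (term_of C N)"
      using C False N_even by (simp add: SONC_generator_square_monomial)
    from SONC_add_generator[OF _ this SONC_0, of 1] show ?thesis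
      by (simp add: term_of_mult)
  qed
  then have "p \<in> SONC D"
    unfolding p_eq using \<mu>_nonneg generator by (intro SONC_add_sum) auto
  moreover have "sum_of_squares p"
  proof -
    have "\<exists>q. g s = q\<^sup>2" for s
    proof -
      obtain r where
        "amgm_poly (exchange \<alpha> (fst s) (snd s)) (exchange \<alpha> (snd s) (fst s)) N = r\<^sup>2"
        by (rule amgm_poly_square[OF exch_even exch_even mid])
      then show ?thesis
        by (auto simp: g_def case_prod_unfold)
    qed
    then obtain q where q: "\<And>s. g s = (q s)\<^sup>2"
      by metis
    obtain u where u: "N = u + u"
      using N_even by (rule expo_even_halve)
    have "const_poly C * (monom_of u)\<^sup>2 = term_of C N"
      by (simp add: u power2_eq_square term_of_mult)
    with sum_of_squares_add_scaled_square[OF C sum_of_squares_0, of "monom_of u"]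
    have "sum_of_squares (term_of C N)"
      by simp
    then show ?thesis
      unfolding p_eq q using \<mu>_nonneg by (intro sum_of_squares_add_sum) auto
  qed
  ultimately show ?thesis
    using deg by (simp add: SOS_def sum_of_squares_def)
qed

section \<open>A polynomial outside AHI\<close>

definition one_plus_square :: "'n \<Rightarrow> ('n::finite) rpoly"
  where "one_plus_square i = term_of 1 0 + term_of 1 (Poly_Mapping.single i 2)"

lemma single_2_nonzero: "Poly_Mapping.single i (2::nat) \<noteq> 0"
  by (metis lookup_single_eq lookup_zero zero_neq_numeral)

lemma expo_degree_single: "expo_degree (Poly_Mapping.single i k) = k"
  by (simp add: expo_degree_def lookup_single when_def)

lemma degree_le_one_plus_square: "D \<ge> 2 \<Longrightarrow> degree_le (one_plus_square i) D"
  unfolding one_plus_square_def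
  by (intro degree_le_add degree_le_term_of) (simp_all add: expo_degree_single, simp add: expo_degree_def)

lemma one_plus_square_SOS:
  assumes "D \<ge> 2"
  shows "one_plus_square i \<in> SOS D"
proof -
  let ?x = "monom_of (Poly_Mapping.single i 1) :: 'a rpoly"
  have "Poly_Mapping.single i 1 + Poly_Mapping.single i 1 = Poly_Mapping.single i (2::nat)"
    by (simp add: numeral_2_eq_2 flip: single_add)
  then have "one_plus_square i = (monom_of 0)\<^sup>2 + (?x\<^sup>2 + 0)"
    by (simp add: one_plus_square_def power2_eq_square term_of_mult)
  then have "sum_of_squares (one_plus_square i)"
    using sum_of_squares_add_square sum_of_squares_0 by metis
  then show ?thesis
    using degree_le_one_plus_square[OF assms] by (simp add: SOS_def sum_of_squares_def)
qed

lemma one_plus_square_SONC: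
  assumes "D \<ge> 2"
  shows "one_plus_square i \<in> SONC D"
proof -
  have "SONC_generator D (monom_of 0 :: 'a rpoly)"
    by (rule SONC_generator_square_monomial) (simp_all add: expo_even_def expo_degree_def)
  moreover have "SONC_generator D (monom_of (Poly_Mapping.single i 2))"
    using assms
    by (intro SONC_generator_square_monomial)
       (simp_all add: expo_degree_single expo_even_def lookup_single when_def)
  ultimately have "const_poly 1 * monom_of 0
      + (const_poly 1 * monom_of (Poly_Mapping.single i 2) + 0) \<in> SONC D"
    by (intro SONC_add_generator SONC_0) simp_all
  then show ?thesis
    by (simp add: one_plus_square_def term_of_mult)
qed

text \<open>
  The centre of reflection can be \<open>0\<close> or not. If it is, \<open>2 e\<^sub>i\<close> would be reflected to \<open>- 2 e\<^sub>i\<close>;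
  otherwise \<open>0\<close> must be reflected to \<open>2 e\<^sub>i\<close>, and the centre is the odd exponent \<open>e\<^sub>i\<close>.
\<close>

lemma one_plus_square_not_AHI: "\<not> AHI_polynomial D (one_plus_square i)"
proof
  let ?e = "Poly_Mapping.single i (2::nat)"
  assume "AHI_polynomial D (one_plus_square i)"
  then obtain N where N_even: "expo_even N"
    and reflect: "\<And>\<beta>. \<beta> \<in> Poly_Mapping.keys (one_plus_square i) \<Longrightarrow> \<beta> \<noteq> N \<Longrightarrow>
      \<exists>\<gamma>\<in>Poly_Mapping.keys (one_plus_square i). \<gamma> \<noteq> N \<and> \<beta> + \<gamma> = N + N"
    by (rule AHI_keys_reflect) blast
  have keys: "Poly_Mapping.keys (one_plus_square i) = {0, ?e}"
    using single_2_nonzero[of i]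
    by (auto simp: one_plus_square_def in_keys_iff lookup_add lookup_term_of split: if_splits)
  show False
  proof (cases "N = 0")
    case True
    then have "?e \<in> Poly_Mapping.keys (one_plus_square i)" "?e \<noteq> N"
      using keys single_2_nonzero[of i] by auto
    then obtain \<gamma> where "?e + \<gamma> = N + N"
      using reflect by blast
    then have "Poly_Mapping.lookup (?e + \<gamma>) i = 0"
      using True by simp
    then show False
      by (simp add: lookup_add)
  next
    case False
    then obtain \<gamma> where \<gamma>: "\<gamma> \<in> {0, ?e}" "\<gamma> = N + N"
      using reflect[of 0] keys by auto
    have "N + N \<noteq> 0"
      using False expo_double_cancel[of N 0] by auto
    with \<gamma> have "?e = N + N"
      by auto
    then have "Poly_Mapping.lookup (N + N) i = 2"
      by (metis lookup_single_eq)
    then have "Poly_Mapping.lookup N i = 1"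
      by (simp add: lookup_add)
    then show False
      using N_even unfolding expo_even_def by (metis odd_one)
  qed
qed

theorem proposition4p3:
  fixes d :: nat
  assumes "CARD('n::finite) \<ge> 4" and "d \<ge> 1"
  shows "(AHI (2 * d) :: 'n rpoly set) \<subset> SOS (2 * d) \<inter> SONC (2 * d)"
proof (rule psubsetI)
  show "(AHI (2 * d) :: 'n rpoly set) \<subseteq> SOS (2 * d) \<inter> SONC (2 * d)"
    using AHI_subset_SOS_SONC by blast
  have "2 * d \<ge> 2"
    using assms(2) by simp
  then have "one_plus_square i \<in> SOS (2 * d) \<inter> SONC (2 * d) - AHI (2 * d)" for i :: 'n
    using one_plus_square_SOS[of _ i] one_plus_square_SONC[of _ i] one_plus_square_not_AHI[of _ i]
    by (auto simp: AHI_def)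
  then show "(AHI (2 * d) :: 'n rpoly set) \<noteq> SOS (2 * d) \<inter> SONC (2 * d)"
    by blast
qed

end
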